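(* Let $(a_n)_{n\ge 0}$ be a strictly increasing sequence of positive real numbers such that $a_n\to\infty$ as $n\to\infty$, $$\frac{a_{n-1}-a_{n-2}}{a_n-a_{n-1}}>1,\qquad\text{for all } n\ge 2,$$ and $$\frac{a_n}{a_{n-1}}\to 1\quad\text{and}\quad \frac{a_{n-1}-a_{n-2}}{a_n-a_{n-1}}\to 1\qquad\text{as } n\to\infty.$$ Then the sequence $b_n=\log a_n$ has the same properties, for indices $n$ such that $\log a_n>0$: that is, $$\frac{b_{n-1}-b_{n-2}}{b_n-b_{n-1}}>1\qquad\text{for all } n\ge 2 \text{ with } \log a_n>0,$$ and $$\frac{b_n}{b_{n-1}}\to 1\quad\text{and}\quad \frac{b_{n-1}-b_{n-2}}{b_n-b_{n-1}}\to 1\qquad\text{as } n\to\infty.$$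
   Context: Here $\log$ is the natural logarithm. The ratio $b_n/b_{n-1}$ is considered for indices large enough that $b_{n-1}>0$. *)

theory Defs
  imports Complex_Main
begin

end

theory Submission
  imports Defs
begin

text \<open>
  For \<open>0 < x < y\<close> the increment of the logarithm is squeezed between two multiples of
  \<open>y - x\<close>, namely \<open>(y - x) / y \<le> ln y - ln x \<le> (y - x) / x\<close>. Applied to two consecutive
  increments of \<open>a\<close>, with the point shared by both used as the common denominator, this shows that
  passing to logarithms can only enlarge the ratio of consecutive increments, and by a factor of at
  most \<open>a n / a (n - 2)\<close> (lemma \<open>ln_increment_ratio_bounds\<close>). The lower bound gives the strict
  inequality at once. Since \<open>a n / a (n - 2)\<close> is a product of two consecutive quotients of \<open>a\<close>, it
  tends to \<open>1\<close>, so the ratio of increments of \<open>ln a\<close> has the same limit as that of \<open>a\<close>.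

  For the quotient of logarithms, \<open>ln (a n) = ln (a (n - 1)) + ln (a n / a (n - 1))\<close>, where the
  last term tends to \<open>0\<close> while \<open>ln (a (n - 1))\<close> tends to infinity.
\<close>

text \<open>Both bounds are the tangent estimate \<open>ln t \<le> t - 1\<close>, at \<open>t = y / x\<close> and at \<open>t = x / y\<close>.\<close>

lemma ln_increment_bounds:
  fixes x y :: real
  assumes "0 < x" "0 < y"
  shows "(y - x) / y \<le> ln y - ln x" and "ln y - ln x \<le> (y - x) / x"
proof -
  have "ln (x / y) \<le> x / y - 1" "ln (y / x) \<le> y / x - 1"
    using assms by (auto intro: ln_le_minus_one)
  then show "(y - x) / y \<le> ln y - ln x" "ln y - ln x \<le> (y - x) / x"
    using assms by (auto simp: ln_div diff_divide_distrib)
qed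

text \<open>
  For the lower bound both increments are compared with multiples of \<open>1 / y\<close>, so that the factor
  cancels; the upper bound has to use \<open>1 / x\<close> and \<open>1 / z\<close> instead, which costs \<open>z / x\<close>.
\<close>

lemma ln_increment_ratio_bounds:
  fixes x y z :: real
  assumes "0 < x" "x < y" "y < z"
  shows "(y - x) / (z - y) \<le> (ln y - ln x) / (ln z - ln y)"
    and "(ln y - ln x) / (ln z - ln y) \<le> (y - x) / (z - y) * (z / x)"
proof -
  have pos: "0 < ln z - ln y" using assms by simp
  have "(y - x) / (z - y) = ((y - x) / y) / ((z - y) / y)"
    using assms by simp
  also have "\<dots> \<le> (ln y - ln x) / (ln z - ln y)"
    using assms pos by (intro frac_le ln_increment_bounds) auto
  finally show "(y - x) / (z - y) \<le> (ln y - ln x) / (ln z - ln y)" .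
  have "(ln y - ln x) / (ln z - ln y) \<le> ((y - x) / x) / ((z - y) / z)"
    using assms by (intro frac_le ln_increment_bounds) auto
  also have "\<dots> = (y - x) / (z - y) * (z / x)"
    by (simp add: field_simps)
  finally show "(ln y - ln x) / (ln z - ln y) \<le> (y - x) / (z - y) * (z / x)" .
qed

theorem theorem4p1:
  fixes a b :: "nat \<Rightarrow> real"
  assumes "strict_mono a"
    and "\<And>n. a n > 0"
    and "filterlim a at_top sequentially"
    and "\<And>n. n \<ge> 2 \<Longrightarrow> (a (n - 1) - a (n - 2)) / (a n - a (n - 1)) > 1"
    and "(\<lambda>n. a n / a (n - 1)) \<longlonglongrightarrow> 1"
    and "(\<lambda>n. (a (n - 1) - a (n - 2)) / (a n - a (n - 1))) \<longlonglongrightarrow> 1"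
    and "\<And>n. b n = ln (a n)"
  shows "(\<forall>n\<ge>2. ln (a n) > 0 \<longrightarrow> (b (n - 1) - b (n - 2)) / (b n - b (n - 1)) > 1) \<and>
    (\<lambda>n. b n / b (n - 1)) \<longlonglongrightarrow> 1 \<and>
    (\<lambda>n. (b (n - 1) - b (n - 2)) / (b n - b (n - 1))) \<longlonglongrightarrow> 1"
proof (intro conjI allI impI)
  note mono = assms(1) and pos = assms(2) and lim = assms(3) and decr = assms(4)
    and quot = assms(5) and ratio = assms(6) and b = assms(7)
  have less: "a (n - 2) < a (n - 1)" "a (n - 1) < a n" if "n \<ge> 2" for n
    using that by (auto intro!: strict_monoD[OF mono])
  note bounds = ln_increment_ratio_bounds[OF pos less]
  have shift: "filterlim (\<lambda>n::nat. n - 1) sequentially sequentially"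
    by (rule filterlim_minus_const_nat_at_top)

  show "(b (n - 1) - b (n - 2)) / (b n - b (n - 1)) > 1" if "n \<ge> 2" for n
    using decr[OF that] bounds(1)[OF that that] unfolding b by linarith

  have lim_b: "filterlim (\<lambda>n. b (n - 1)) at_top sequentially"
    unfolding b by (intro filterlim_compose[OF ln_at_top] filterlim_compose[OF lim] shift)
  have "(\<lambda>n. ln (a n / a (n - 1))) \<longlonglongrightarrow> ln 1"
    by (intro tendsto_ln quot) auto
  then have "(\<lambda>n. ln (a n / a (n - 1)) / b (n - 1)) \<longlonglongrightarrow> 0"
    by (rule real_tendsto_divide_at_top[OF _ lim_b])
  then have "(\<lambda>n. 1 + ln (a n / a (n - 1)) / b (n - 1)) \<longlonglongrightarrow> 1 + 0"
    by (intro tendsto_intros)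
  moreover have "\<forall>\<^sub>F n in sequentially. 1 + ln (a n / a (n - 1)) / b (n - 1) = b n / b (n - 1)"
  proof -
    have "\<forall>\<^sub>F n in sequentially. b (n - 1) > 0"
      using lim_b by (simp add: filterlim_at_top_dense)
    then show ?thesis
      by eventually_elim (simp add: b ln_div field_simps pos less_imp_neq[OF pos, symmetric])
  qed
  ultimately show "(\<lambda>n. b n / b (n - 1)) \<longlonglongrightarrow> 1"
    by (simp add: tendsto_cong)

  have "(\<lambda>n. a n / a (n - 1) * (a (n - 1) / a (n - 1 - 1))) \<longlonglongrightarrow> 1 * 1"
    by (intro tendsto_mult quot filterlim_compose[OF quot shift])
  moreover have "a n / a (n - 1) * (a (n - 1) / a (n - 1 - 1)) = a n / a (n - 2)" for n
    using pos[of "n - 1"] by (simp add: numeral_2_eq_2)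
  ultimately have "(\<lambda>n. a n / a (n - 2)) \<longlonglongrightarrow> 1"
    by simp
  from tendsto_mult[OF ratio this]
  have upper: "(\<lambda>n. (a (n - 1) - a (n - 2)) / (a n - a (n - 1)) * (a n / a (n - 2))) \<longlonglongrightarrow> 1"
    by simp
  show "(\<lambda>n. (b (n - 1) - b (n - 2)) / (b n - b (n - 1))) \<longlonglongrightarrow> 1"
    unfolding b
    by (rule tendsto_sandwich[OF _ _ ratio upper];
        rule eventually_sequentiallyI[of 2]; rule bounds)
qed

end
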